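(* Let $X,H,M\ge1$ with $X^{1/3}\le H\le X$ and $M\le C_0X^{1/2}$ for a fixed constant $C_0$, and let $J$ be a subinterval of $(M,2M]$. Then there are constants $0<c_1<c_2$ and $C>0$ depending only on $C_0$ such that for any integer $Q$ with $\frac MH\le Q\le\frac M{(HX)^{1/4}}$, the set $\{(m,n)\in\mathbb Z^2:m\in J,\ X<nm\le X+H\}$ can be partitioned as $$\bigcup_{q=1}^Q\ \bigcup_{\substack{c_1\frac X{M^2}q\le a\le c_2\frac X{M^2}q\\ \gcd(a,q)=1}}\ \bigcup_{P\in\mathcal P_{a,q}}P,$$ where for each such coprime pair $(a,q)$, $\mathcal P_{a,q}$ is a family of at most $C\frac{M^3}{XQ^2q}$ arithmetic progressions $P$ contained in the set, each of spacing $(q,-a)$ and length at most $\frac{HQ}M$.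
   Context: An arithmetic progression in $\mathbb Z^2$ of spacing $v$ is a set $\{x_0+jv:0\le j<\ell\}$, with $\ell$ its length. *)

theory Defs
  imports "HOL-Analysis.Analysis"
begin

definition AP_pts :: "int \<times> int \<Rightarrow> int \<times> int \<Rightarrow> nat \<Rightarrow> (int \<times> int) set" where
  "AP_pts x0 v l = {(fst x0 + int j * fst v, snd x0 + int j * snd v) | j. j < l}"

definition is_AP :: "(int \<times> int) set \<Rightarrow> int \<times> int \<Rightarrow> real \<Rightarrow> bool" where
  "is_AP P v L \<longleftrightarrow> (\<exists>x0 l. 1 \<le> l \<and> real l \<le> L \<and> P = AP_pts x0 v l)"

definition hyp_set :: "real \<Rightarrow> real \<Rightarrow> real set \<Rightarrow> (int \<times> int) set" where
  "hyp_set X H J = {(m, n). real_of_int m \<in> J \<and> X < real_of_int (n * m) \<and> real_of_int (n * m) \<le> X + H}"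

end

theory Submission
  imports Defs
begin

text \<open>
  A point \<open>(m, n)\<close> is assigned to the fraction \<open>a/q\<close> with least denominator that approximates
  the slope \<open>X/m\<^sup>2\<close> of the hyperbola within \<open>1/(qQ)\<close>. The slopes assigned to one fraction form
  an interval. On the line \<open>am + qn = c\<close> put \<open>d = am - qn\<close>; the identity \<open>d\<^sup>2 = c\<^sup>2 - 4aq\<cdot>nm\<close>
  shows that the points with a given sign of \<open>d\<close> are consecutive, and cutting them into
  blocks gives the progressions. To count them, write \<open>c' = 2\<surd>(aqX)\<close> for the value of \<open>c\<close> at
  which the line is tangent to the hyperbola: only \<open>c' < c \<le> c' + O(R)\<close> with
  \<open>R = M\<^sup>3/(XQ\<^sup>2q) \<ge> 1\<close> occurs, and on the \<open>j\<close>-th such line \<open>d\<close> ranges over an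
  interval of length at most \<open>min(\<surd>B, B/\<surd>(2c'j))\<close>, \<open>B = 4aqH\<close>, which sums to \<open>O(R)\<close> blocks.
\<close>

section \<open>Rational approximation of slopes with least denominator\<close>

definition approx_den :: "int \<Rightarrow> real \<Rightarrow> nat" where
  "approx_den Q x = (LEAST q. 1 \<le> q \<and> (\<exists>a::int. \<bar>real q * x - of_int a\<bar> < 1 / of_int Q))"

text \<open>Rounding selects a nearest numerator, so it is as good as any admissible one, and for a
  fixed denominator it is monotone in \<open>x\<close>.\<close>

definition approx_num :: "int \<Rightarrow> real \<Rightarrow> int" where
  "approx_num Q x = round (real (approx_den Q x) * x)"

lemma approx_den_le:
  assumes "1 \<le> q" "\<bar>real q * x - of_int a\<bar> < 1 / of_int Q"
  shows "approx_den Q x \<le> q"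
  unfolding approx_den_def by (rule Least_le) (use assms in blast)

lemma approx_den_num:
  assumes "1 \<le> Q"
  shows "1 \<le> approx_den Q x" "int (approx_den Q x) \<le> Q"
    "\<bar>real (approx_den Q x) * x - of_int (approx_num Q x)\<bar> < 1 / of_int Q"
proof -
  have "0 < nat Q" using assms by simp
  then obtain h k where hk: "0 < k" "k \<le> int (nat Q)" "\<bar>of_int k * x - of_int h\<bar> < 1 / real (nat Q)"
    using Dirichlet_approx by blast
  let ?P = "\<lambda>q. 1 \<le> q \<and> (\<exists>a::int. \<bar>real q * x - of_int a\<bar> < 1 / of_int Q)"
  have k: "1 \<le> nat k" "\<bar>real (nat k) * x - of_int h\<bar> < 1 / of_int Q"
    using hk assms by auto
  then have "?P (nat k)" by blast
  then have P: "?P (approx_den Q x)" unfolding approx_den_def by (rule LeastI)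
  then show "1 \<le> approx_den Q x" by blast
  show "int (approx_den Q x) \<le> Q" using approx_den_le[OF k] hk(2) assms by linarith
  from P obtain a :: int where "\<bar>real (approx_den Q x) * x - of_int a\<bar> < 1 / of_int Q" by blast
  moreover have "\<bar>real (approx_den Q x) * x - of_int (approx_num Q x)\<bar> \<le> \<bar>real (approx_den Q x) * x - of_int a\<bar>"
    unfolding approx_num_def by (metis round_diff_minimal abs_minus_commute)
  ultimately show "\<bar>real (approx_den Q x) * x - of_int (approx_num Q x)\<bar> < 1 / of_int Q" by linarith
qed

text \<open>Cancelling a common factor \<open>g\<close> would divide the error by \<open>g\<close>
  as well, so the smaller denominator would be admissible, against minimality.\<close>

lemma coprime_approx:
  assumes "1 \<le> Q"
  shows "coprime (approx_num Q x) (int (approx_den Q x))"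
proof -
  define g where "g = gcd (approx_num Q x) (int (approx_den Q x))"
  have "g > 0" using approx_den_num(1)[OF assms, of x] by (simp add: g_def)
  obtain a where a: "approx_num Q x = g * a" using gcd_dvd1 g_def by blast
  obtain b where b: "int (approx_den Q x) = g * b" using gcd_dvd2 g_def by blast
  have "b > 0" using b \<open>g > 0\<close> approx_den_num(1)[OF assms, of x]
    by (metis of_nat_0_less_iff zero_less_mult_pos order_less_le_trans zero_less_one)
  have rb: "real (approx_den Q x) = of_int g * of_int b"
    by (metis b of_int_mult of_int_of_nat_eq)
  have "of_int g * \<bar>of_int b * x - of_int a\<bar> < 1 / of_int Q"
    using approx_den_num(3)[OF assms, of x] \<open>g > 0\<close>
    by (simp add: rb a abs_mult_pos' right_diff_distrib mult.assoc)
  moreover have "1 * \<bar>of_int b * x - of_int a\<bar> \<le> of_int g * \<bar>of_int b * x - of_int a\<bar>"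
    using \<open>g > 0\<close> by (intro mult_right_mono) auto
  ultimately have "\<bar>real (nat b) * x - of_int a\<bar> < 1 / of_int Q"
    using \<open>b > 0\<close> by simp
  then have "approx_den Q x \<le> nat b" using \<open>b > 0\<close> by (intro approx_den_le) auto
  then have "g * b \<le> 1 * b" using b \<open>b > 0\<close> by linarith
  then have "g = 1" using \<open>b > 0\<close> \<open>g > 0\<close> by (simp add: mult_le_cancel_right)
  then show ?thesis by (simp add: g_def coprime_iff_gcd_eq_1)
qed

text \<open>Here \<open>y\<close> lies between \<open>x\<close> and its fraction
  \<open>z = p / q\<close>. Suppose some \<open>a' / q'\<close> with \<open>q' < q\<close> were
  admissible at \<open>y\<close>. Then \<open>q' * x - a'\<close> and \<open>q' * z - a'\<close>
  both have absolute value at least \<open>1 / Q\<close> but differ by less than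
  \<open>1 / Q\<close>, so they have the same sign; \<open>q' * y - a'\<close> lies between them and
  cannot be smaller in absolute value than \<open>1 / Q\<close>.\<close>

lemma cell_star_shaped:
  assumes Q: "1 \<le> Q"
    and y: "of_int (approx_num Q x) \<le> real (approx_den Q x) * y \<and> y \<le> x \<or>
      x \<le> y \<and> real (approx_den Q x) * y \<le> of_int (approx_num Q x)"
  shows "approx_den Q y = approx_den Q x" "approx_num Q y = approx_num Q x"
proof -
  define q p where "q = approx_den Q x" and "p = approx_num Q x"
  define \<delta> :: real where "\<delta> = 1 / of_int Q"
  have q: "1 \<le> q" "int q \<le> Q" and x: "\<bar>real q * x - of_int p\<bar> < \<delta>"
    using approx_den_num[OF Q, of x] by (auto simp: q_def p_def \<delta>_def)
  have y': "of_int p \<le> real q * y \<and> y \<le> x \<or> x \<le> y \<and> real q * y \<le> of_int p"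
    using y by (simp add: q_def p_def)
  then have btw: "of_int p \<le> real q * y \<and> real q * y \<le> real q * x \<or>
      real q * x \<le> real q * y \<and> real q * y \<le> of_int p"
    using q by (auto intro: mult_left_mono)
  then have "\<bar>real q * y - of_int p\<bar> < \<delta>" using x by linarith
  then have "approx_den Q y \<le> q" using q by (intro approx_den_le) (auto simp: \<delta>_def)
  moreover have False if lt: "approx_den Q y < q"
  proof -
    define q' a' where "q' = approx_den Q y" and "a' = approx_num Q y"
    have q': "1 \<le> q'" "q' < q" and w: "\<bar>real q' * y - of_int a'\<bar> < \<delta>"
      using approx_den_num[OF Q, of y] lt by (auto simp: q'_def a'_def \<delta>_def)
    have u: "\<bar>real q' * x - of_int a'\<bar> \<ge> \<delta>"
      using approx_den_le[of q' x a' Q] q' by (fastforce simp: q_def \<delta>_def)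
    define z where "z = of_int p / real q"
    have qz: "real q * z = of_int p" using q by (simp add: z_def)
    have "real q * \<bar>x - z\<bar> < \<delta>"
      using x q by (simp add: abs_mult_pos' right_diff_distrib qz)
    moreover have "real q' * \<bar>x - z\<bar> \<le> real q * \<bar>x - z\<bar>"
      using q' by (intro mult_right_mono) auto
    ultimately have uv: "\<bar>real q' * x - real q' * z\<bar> < \<delta>"
      by (simp add: abs_mult_pos' flip: right_diff_distrib)
    have v: "\<bar>real q' * z - of_int a'\<bar> \<ge> \<delta>"
    proof -
      \<comment> \<open>If the two fractions coincided, \<open>a'\<close> and \<open>q'\<close>
        would be admissible at \<open>x\<close> already, with a denominator below
        \<open>q\<close>.\<close>
      have "int q' * p - a' * int q \<noteq> 0"
      proof
        assume "int q' * p - a' * int q = 0"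
        then have "real q' * of_int p = of_int a' * real q"
          by (metis eq_iff_diff_eq_0 of_int_mult of_int_of_nat_eq)
        then have "real q' * z = of_int a'" using q by (simp add: z_def field_simps)
        then show False using uv u by simp
      qed
      then have "1 \<le> \<bar>real_of_int (int q' * p - a' * int q)\<bar>" by linarith
      also have "\<dots> = real q * \<bar>real q' * z - of_int a'\<bar>"
        using q by (simp add: abs_mult_pos' z_def field_simps)
      finally have "1 / real q \<le> \<bar>real q' * z - of_int a'\<bar>"
        using q by (simp add: field_simps)
      \<comment> \<open>Equality occurs for \<open>q = Q\<close>; the contradiction then rests on
        the strict inequality in \<open>approx_den\<close>.\<close>
      moreover have "\<delta> \<le> 1 / real q" using q unfolding \<delta>_def by (intro divide_left_mono) auto
      ultimately show ?thesis by linarith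
    qed
    have "z \<le> y \<and> y \<le> x \<or> x \<le> y \<and> y \<le> z"
      using y' q by (auto simp: z_def field_simps)
    then have "real q' * z \<le> real q' * y \<and> real q' * y \<le> real q' * x \<or>
      real q' * x \<le> real q' * y \<and> real q' * y \<le> real q' * z"
      by (auto intro: mult_left_mono)
    then show False using u v w uv by linarith
  qed
  ultimately have den_eq: "approx_den Q y = q" by (meson le_neq_implies_less)
  then show "approx_den Q y = approx_den Q x" by (simp add: q_def)
  have "round (real q * x) = p" by (simp add: p_def q_def approx_num_def)
  moreover have "p \<le> round (real q * y) \<and> round (real q * y) \<le> round (real q * x) \<or>
      round (real q * x) \<le> round (real q * y) \<and> round (real q * y) \<le> p"
    using btw round_mono by (metis round_of_int)
  ultimately have "round (real q * y) = p" by linarith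
  then show "approx_num Q y = approx_num Q x" using den_eq by (simp add: approx_num_def p_def)
qed

text \<open>The point \<open>y\<close> lies between the common fraction and one of the two ends, so
  \<open>cell_star_shaped\<close> applies from that end.\<close>

lemma cell_convex:
  assumes "1 \<le> Q" "approx_den Q x = approx_den Q z" "approx_num Q x = approx_num Q z" "x \<le> y" "y \<le> z"
  shows "approx_den Q y = approx_den Q z" "approx_num Q y = approx_num Q z"
proof -
  have "approx_den Q y = approx_den Q z \<and> approx_num Q y = approx_num Q z"
    using cell_star_shaped[OF assms(1), of x y] cell_star_shaped[OF assms(1), of z y] assms
    by (metis linear)
  then show "approx_den Q y = approx_den Q z" "approx_num Q y = approx_num Q z" by auto
qed

section \<open>Lattice points on a line: progressions, blocks and extents\<close>

text \<open>Coprimality confines \<open>m\<close> to one residue class modulo \<open>q\<close>,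
  convexity excludes gaps, and a common quotient by \<open>q * K\<close> leaves room for at most
  \<open>K\<close> members of the class.\<close>

lemma convex_line_set_is_AP:
  fixes a q c k :: int and K :: nat
  assumes q: "1 \<le> q" and cop: "coprime a q" and "finite S" "S \<noteq> {}"
    and line: "\<And>m n. (m, n) \<in> S \<Longrightarrow> a * m + q * n = c"
    and block: "\<And>m n. (m, n) \<in> S \<Longrightarrow> m div (q * int K) = k"
    and conv: "\<And>m n m1 n1 m2 n2. (m1, n1) \<in> S \<Longrightarrow> (m2, n2) \<in> S \<Longrightarrow> m1 \<le> m \<Longrightarrow> m \<le> m2 \<Longrightarrow>
      a * m + q * n = c \<Longrightarrow> (m, n) \<in> S"
    and K: "1 \<le> K" "real K \<le> L"
  shows "is_AP S (q, - a) L"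
proof -
  define m0 m1 where "m0 = Min (fst ` S)" and "m1 = Max (fst ` S)"
  have "m0 \<in> fst ` S" "m1 \<in> fst ` S" using assms(3,4) by (auto simp: m0_def m1_def)
  then obtain n0 n1 where S0: "(m0, n0) \<in> S" and S1: "(m1, n1) \<in> S" by auto
  have bd: "m0 \<le> m \<and> m \<le> m1" if "(m, n) \<in> S" for m n
    using that assms(3) unfolding m0_def m1_def by (metis Max_ge Min_le finite_imageI fst_conv imageI)
  have dvd: "q dvd m - m0" if "(m, n) \<in> S" for m n
  proof -
    have "a * (m - m0) = q * (n0 - n)" using line[OF that] line[OF S0] by (simp add: algebra_simps)
    then have "q dvd a * (m - m0)" by simp
    then show ?thesis using cop by (simp add: coprime_commute coprime_dvd_mult_right_iff)
  qed
  define l where "l = nat ((m1 - m0) div q + 1)"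
  have m01: "m0 \<le> m1" using bd[OF S0] by simp
  have l: "int l = (m1 - m0) div q + 1"
    using m01 q by (simp add: l_def pos_imp_zdiv_nonneg_iff)
  have m1: "m1 - m0 = q * (int l - 1)" using dvd[OF S1] l by simp
  have "q * int K > 0" using q K by simp
  then have "m1 - m0 < q * int K" using block[OF S0] block[OF S1]
    by (smt (verit) div_mult_mod_eq pos_mod_bound pos_mod_sign)
  then have "q * (int l - 1) < q * int K" using m1 by simp
  then have "l \<le> K" using q by simp
  have "S = AP_pts (m0, n0) (q, - a) l"
  proof (intro equalityI subsetI)
    fix p assume "p \<in> S"
    then obtain m n where p: "p = (m, n)" "(m, n) \<in> S" by (metis surj_pair)
    obtain i where i: "m - m0 = q * i" using dvd[OF p(2)] by blast
    have "0 \<le> q * i" "q * i \<le> q * (int l - 1)" using bd[OF p(2)] i m1 by linarith+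
    then have i2: "0 \<le> i" "i \<le> int l - 1" using q by (auto simp: zero_le_mult_iff)
    have "q * n = q * (n0 - i * a)" using line[OF p(2)] line[OF S0] i by (simp add: algebra_simps)
    then have "n = n0 - i * a" using q by simp
    then show "p \<in> AP_pts (m0, n0) (q, - a) l"
      using i i2 p(1) unfolding AP_pts_def by (auto intro!: exI[of _ "nat i"] simp: algebra_simps)
  next
    fix p assume "p \<in> AP_pts (m0, n0) (q, - a) l"
    then obtain j where j: "j < l" "p = (m0 + int j * q, n0 - int j * a)"
      unfolding AP_pts_def by auto
    have "q * int j \<le> q * (int l - 1)" using j(1) q by (intro mult_left_mono) auto
    then have "m0 + int j * q \<le> m1" using m1 by (simp add: algebra_simps)
    moreover have "a * (m0 + int j * q) + q * (n0 - int j * a) = c"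
      using line[OF S0] by (simp add: algebra_simps)
    ultimately show "p \<in> S" using conv[OF S0 S1] j(2) q by simp
  qed
  moreover have "0 \<le> (m1 - m0) div q" using m01 q by (simp add: pos_imp_zdiv_nonneg_iff)
  then have "1 \<le> l" using l by linarith
  ultimately show ?thesis using \<open>l \<le> K\<close> K(2) unfolding is_AP_def
    by (intro exI[of _ "(m0, n0)"] exI[of _ l]) auto
qed

text \<open>In the 2, one unit comes from rounding the first block index down and one from counting
  both end blocks.\<close>

lemma card_blocks_le:
  fixes S :: "int set" and b :: int and L :: real
  assumes b: "1 \<le> b" and "finite S" "0 \<le> L"
    and diam: "\<And>m m'. m \<in> S \<Longrightarrow> m' \<in> S \<Longrightarrow> of_int \<bar>m - m'\<bar> \<le> L"
  shows "real (card ((\<lambda>m. m div b) ` S)) \<le> L / of_int b + 2"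
proof (cases "S = {}")
  case False
  define m0 where "m0 = Min S"
  have m0: "m0 \<in> S" "\<And>m. m \<in> S \<Longrightarrow> m0 \<le> m" using False assms(2) by (auto simp: m0_def)
  define u v where "u = m0 div b" and "v = \<lfloor>(of_int m0 + L) / of_int b\<rfloor>"
  have u: "u = \<lfloor>real_of_int m0 / of_int b\<rfloor>" by (simp add: u_def floor_divide_of_int_eq)
  have "(\<lambda>m. m div b) ` S \<subseteq> {u..v}"
  proof
    fix t assume "t \<in> (\<lambda>m. m div b) ` S"
    then obtain m where m: "m \<in> S" "t = m div b" by blast
    have "real_of_int m \<le> of_int m0 + L" using diam[OF m(1) m0(1)] by linarith
    then have "real_of_int m / of_int b \<le> (of_int m0 + L) / of_int b"
      using b by (intro divide_right_mono) auto
    then have "t \<le> v" unfolding v_def m(2) by (metis floor_divide_of_int_eq floor_mono)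
    moreover have "u \<le> t" unfolding u_def m(2) using m0(2)[OF m(1)] b by (intro zdiv_mono1) auto
    ultimately show "t \<in> {u..v}" by simp
  qed
  then have "card ((\<lambda>m. m div b) ` S) \<le> card {u..v}" by (intro card_mono) auto
  then have "real (card ((\<lambda>m. m div b) ` S)) \<le> real (card {u..v})" by simp
  also have "\<dots> \<le> L / of_int b + 2"
  proof -
    have "real_of_int v - of_int u \<le> (of_int m0 + L) / of_int b - of_int m0 / of_int b + 1"
      unfolding v_def u by linarith
    also have "\<dots> = L / of_int b + 1" by (simp add: add_divide_distrib)
    finally have "real_of_int v - of_int u \<le> L / of_int b + 1" .
    moreover have "0 \<le> L / of_int b" using assms(3) b by simp
    ultimately show ?thesis by (simp add: of_nat_nat max_def)
  qed
  finally show ?thesis .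
qed (use assms in simp)

text \<open>By the arithmetic-geometric mean inequality the term \<open>1 / sqrt (Suc N)\<close> is
  at most \<open>2 * sqrt (Suc N) - 2 * sqrt N\<close>, and these differences telescope.\<close>

lemma sum_inverse_sqrt_le: "(\<Sum>j=1..N. 1 / sqrt (real j)) \<le> 2 * sqrt (real N)"
proof (induction N)
  case (Suc N)
  have "sqrt (real N) * sqrt (real (Suc N)) \<le> (real N + real (Suc N)) / 2"
    by (rule arith_geo_mean_sqrt[THEN order_trans[rotated]]) (auto simp: real_sqrt_mult)
  then have "1 \<le> (2 * sqrt (real (Suc N)) - 2 * sqrt (real N)) * sqrt (real (Suc N))"
    by (simp add: left_diff_distrib mult.assoc del: of_nat_Suc) simp
  then have "1 / sqrt (real (Suc N)) \<le> 2 * sqrt (real (Suc N)) - 2 * sqrt (real N)"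
    by (simp add: divide_le_eq)
  then show ?case using Suc by simp
qed simp

text \<open>For \<open>0 <= y <= x <= sqrt u\<close>, both \<open>(x - y)^2 <= x^2 - y^2\<close> and
  \<open>(x - y) * sqrt u <= u - y^2\<close> hold, and both right sides are at most
  \<open>B\<close>. The first bound serves the line closest to tangency, where \<open>u\<close> may
  be tiny; the second serves the others.\<close>

lemma extent_le:
  fixes d d' u B :: real
  assumes d: "u - B \<le> d\<^sup>2" "d\<^sup>2 \<le> u" "u - B \<le> d'\<^sup>2" "d'\<^sup>2 \<le> u" and sgn: "0 \<le> d \<longleftrightarrow> 0 \<le> d'"
  shows "\<bar>d - d'\<bar> \<le> sqrt B" "\<bar>d - d'\<bar> * sqrt u \<le> B"
proof -
  have *: "\<bar>x - y\<bar> \<le> sqrt B \<and> \<bar>x - y\<bar> * sqrt u \<le> B"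
    if "0 \<le> y" "y \<le> x" "x\<^sup>2 \<le> u" "u - B \<le> y\<^sup>2" for x y
  proof
    have "(x - y)\<^sup>2 \<le> x\<^sup>2 - y\<^sup>2"
    proof -
      have "y * y \<le> x * y" using that by (intro mult_right_mono) auto
      then show ?thesis by (simp add: power2_eq_square algebra_simps)
    qed
    then have "(x - y)\<^sup>2 \<le> B" using that by linarith
    then show "\<bar>x - y\<bar> \<le> sqrt B" by (metis real_sqrt_abs real_sqrt_le_mono)
    have u: "0 \<le> u" using that by (smt (verit) zero_le_power2)
    have x: "x \<le> sqrt u" using that by (simp add: real_le_rsqrt)
    have "\<bar>x - y\<bar> * sqrt u \<le> (sqrt u - y) * (sqrt u + y)"
      using that x u by (intro mult_mono) auto
    also have "\<dots> = u - y\<^sup>2" using u by (simp add: algebra_simps power2_eq_square)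
    finally show "\<bar>x - y\<bar> * sqrt u \<le> B" using that by linarith
  qed
  consider "0 \<le> d" "0 \<le> d'" "d \<le> d'" | "0 \<le> d" "0 \<le> d'" "d' \<le> d"
    | "0 \<le> - d" "0 \<le> - d'" "- d \<le> - d'" | "0 \<le> - d" "0 \<le> - d'" "- d' \<le> - d"
    using sgn by linarith
  then have "\<bar>d - d'\<bar> \<le> sqrt B \<and> \<bar>d - d'\<bar> * sqrt u \<le> B"
  proof cases
    case 1 then show ?thesis using *[of d d'] d by (simp add: abs_minus_commute)
  next
    case 2 then show ?thesis using *[of d' d] d by simp
  next
    case 3 then show ?thesis using *[of "- d" "- d'"] d by (simp add: abs_minus_commute)
  next
    case 4 then show ?thesis using *[of "- d'" "- d"] d by (simp add: abs_minus_commute)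
  qed
  then show "\<bar>d - d'\<bar> \<le> sqrt B" "\<bar>d - d'\<bar> * sqrt u \<le> B" by auto
qed

section \<open>Size relations between \<open>X\<close>, \<open>H\<close>, \<open>M\<close> and
  \<open>Q\<close>\<close>

locale hyperbolic_strip =
  fixes C0 X H M :: real and J :: "real set" and Q :: int
  assumes X: "1 \<le> X" and H: "1 \<le> H" and M: "1 \<le> M"
    and X_powr_le: "X powr (1/3) \<le> H" and H_le_X: "H \<le> X" and M_le: "M \<le> C0 * sqrt X"
    and J: "is_interval J" "J \<subseteq> {M<..2*M}"
    and Q_lower: "M / H \<le> of_int Q" and Q_upper: "of_int Q \<le> M / (H * X) powr (1/4)"
begin

text \<open>Slopes are at least \<open>1 / (4 * C0^2)\<close>, so adding 1 to a slope multiplies it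
  by at most this factor.\<close>

definition \<kappa> :: real where "\<kappa> = 1 + 4 * C0\<^sup>2"

text \<open>The summands are the contributions of \<open>d^2\<close> and of the height
  \<open>H\<close> in \<open>line_offset\<close>.\<close>

definition \<tau> :: real where "\<tau> = (2 * \<kappa> + 1)\<^sup>2 + \<kappa>"

text \<open>The largest length allowed for a progression. As \<open>Q >= M / H\<close> makes it at
  least 1, rounding down costs at most a factor 2.\<close>

definition K :: nat where "K = nat \<lfloor>H * of_int Q / M\<rfloor>"

definition R :: "real \<Rightarrow> real" where "R q = M ^ 3 / (X * (of_int Q)\<^sup>2 * q)"

lemma kappa_ge_1: "1 \<le> \<kappa>" by (simp add: \<kappa>_def)

lemma tau_ge_1: "1 \<le> \<tau>" using kappa_ge_1 by (simp add: \<tau>_def add_increasing)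

lemma Q_ge_1: "1 \<le> Q"
proof -
  have "0 < M / H" using M H by simp
  then show ?thesis using Q_lower by linarith
qed

lemma K: "1 \<le> K" "H * of_int Q / (2 * M) \<le> real K" "real K \<le> H * of_int Q / M"
proof -
  define t where "t = H * of_int Q / M"
  have t: "1 \<le> t" using Q_lower H M by (simp add: t_def field_simps)
  then have K: "real K = of_int \<lfloor>t\<rfloor>" by (simp add: K_def t_def)
  then show "real K \<le> H * of_int Q / M" by (simp add: t_def)
  have "1 \<le> \<lfloor>t\<rfloor>" using t by simp
  then show "1 \<le> K" unfolding K_def t_def by linarith
  have "t / 2 \<le> of_int \<lfloor>t\<rfloor>" using t \<open>1 \<le> \<lfloor>t\<rfloor>\<close> by linarith
  then show "H * of_int Q / (2 * M) \<le> real K" by (simp add: K t_def)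
qed

lemma X_le_H_cubed: "X \<le> H ^ 3"
proof -
  have "(X powr (1/3)) ^ 3 = X" using X by (simp flip: powr_realpow add: powr_powr)
  then show ?thesis using power_mono[OF X_powr_le, of 3] by simp
qed

lemma Q_pow_4: "of_int Q ^ 4 * (H * X) \<le> M ^ 4"
proof -
  define P where "P = H * X"
  define r where "r = P powr (1/4)"
  have "0 < P" using H X by (simp add: P_def)
  then have r: "0 < r" "r ^ 4 = H * X" unfolding r_def
    by (simp_all flip: powr_realpow P_def add: powr_powr)
  have "of_int Q * r \<le> M" using Q_upper r(1) by (simp add: field_simps flip: r_def P_def)
  then have "(of_int Q * r) ^ 4 \<le> M ^ 4" using r(1) Q_ge_1 by (intro power_mono) auto
  then show ?thesis by (simp add: power_mult_distrib r(2))
qed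

text \<open>Taking fourth powers avoids fractional exponents: \<open>X <= H^3\<close> reduces the
  claim to the cube of \<open>Q_pow_4\<close>. It says that \<open>R\<close> is at least 1 even at
  \<open>q = Q\<close>.\<close>

lemma Q_cubed: "X * of_int Q ^ 3 \<le> M ^ 3"
proof -
  have "(X * of_int Q ^ 3) ^ Suc 3 = X ^ 3 * X * (of_int Q ^ 4) ^ 3"
    by (simp add: power_mult_distrib algebra_simps eval_nat_numeral)
  also have "\<dots> \<le> X ^ 3 * H ^ 3 * (of_int Q ^ 4) ^ 3"
    using X_le_H_cubed X Q_ge_1 by (intro mult_right_mono mult_left_mono) auto
  also have "\<dots> = (of_int Q ^ 4 * (H * X)) ^ 3" by (simp add: power_mult_distrib)
  also have "\<dots> \<le> (M ^ 4) ^ 3" using Q_pow_4 Q_ge_1 H X by (intro power_mono) auto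
  also have "\<dots> = (M ^ 3) ^ Suc 3" by (simp flip: power_mult)
  finally show ?thesis by (rule power_le_imp_le_base) (use M in simp)
qed

lemma Q_squared: "(of_int Q)\<^sup>2 * H \<le> M\<^sup>2"
proof -
  have "((of_int Q)\<^sup>2 * H) ^ Suc 1 = of_int Q ^ 4 * (H * H)"
    by (simp add: algebra_simps eval_nat_numeral)
  also have "\<dots> \<le> of_int Q ^ 4 * (H * X)" using H H_le_X Q_ge_1 by (intro mult_left_mono) auto
  also have "\<dots> \<le> (M\<^sup>2) ^ Suc 1" using Q_pow_4 by (simp flip: power_mult)
  finally show ?thesis by (rule power_le_imp_le_base) simp
qed

text \<open>Fourth powers again, with one factor \<open>H\<close> cancelled. This inequality
  controls the line closest to tangency.\<close>

lemma Q_sqrt: "of_int Q * sqrt X \<le> M * sqrt H"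
proof -
  have *: "sqrt X ^ 4 = X\<^sup>2" "sqrt H ^ 4 = H\<^sup>2"
    using X H power_mult[of "sqrt X" 2 2] power_mult[of "sqrt H" 2 2] by auto
  have "H * (of_int Q ^ 4 * X\<^sup>2) = (of_int Q ^ 4 * (H * X)) * X"
    by (simp add: power2_eq_square)
  also have "\<dots> \<le> M ^ 4 * H ^ 3" using Q_pow_4 X_le_H_cubed X M by (intro mult_mono) auto
  also have "\<dots> = H * (M ^ 4 * H\<^sup>2)" by (simp add: eval_nat_numeral)
  finally have "of_int Q ^ 4 * X\<^sup>2 \<le> M ^ 4 * H\<^sup>2" using H by simp
  then have "(of_int Q * sqrt X) ^ Suc 3 \<le> (M * sqrt H) ^ Suc 3"
    using * by (simp add: power_mult_distrib)
  then show ?thesis by (rule power_le_imp_le_base) (use M H in simp)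
qed

text \<open>Lets \<open>R\<close> absorb the additive constants of the count; the worst case is
  \<open>q = Q\<close>, settled by \<open>Q_cubed\<close>.\<close>

lemma R_ge_1:
  assumes "1 \<le> q" "q \<le> of_int Q"
  shows "1 \<le> R q"
proof -
  have "X * (of_int Q)\<^sup>2 * q \<le> X * (of_int Q)\<^sup>2 * of_int Q"
    using assms X by (intro mult_left_mono) auto
  also have "\<dots> \<le> M ^ 3" using Q_cubed by (simp add: eval_nat_numeral algebra_simps)
  finally have "X * (of_int Q)\<^sup>2 * q \<le> M ^ 3" .
  moreover have "0 < X * (of_int Q)\<^sup>2 * q" using X Q_ge_1 assms by simp
  ultimately show ?thesis by (simp add: R_def)
qed

text \<open>The quantity \<open>q * H / M\<close> is the order of the shift of the tangent value
  \<open>2 * sqrt (a * q * X)\<close> when \<open>X\<close> grows to \<open>X + H\<close>. Replacing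
  one \<open>q^2\<close> by \<open>Q^2\<close> reduces the claim to \<open>Q_pow_4\<close>.\<close>

lemma strip_height_le:
  assumes "1 \<le> q" "q \<le> of_int Q"
  shows "q * H / M \<le> R q"
proof -
  have q2: "q\<^sup>2 \<le> (of_int Q)\<^sup>2" using assms by (intro power_mono) auto
  have "q * H * (X * (of_int Q)\<^sup>2 * q) = q\<^sup>2 * ((of_int Q)\<^sup>2 * (H * X))"
    by (simp add: power2_eq_square)
  also have "\<dots> \<le> (of_int Q)\<^sup>2 * ((of_int Q)\<^sup>2 * (H * X))"
    using q2 H X by (intro mult_right_mono) auto
  also have "\<dots> \<le> M * M ^ 3" using Q_pow_4 by (simp add: eval_nat_numeral algebra_simps)
  finally have "q * H * (X * (of_int Q)\<^sup>2 * q) \<le> M ^ 3 * M" by (simp add: mult.commute)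
  moreover have "0 < X * (of_int Q)\<^sup>2 * q" using X Q_ge_1 assms by simp
  ultimately show ?thesis using M by (simp add: R_def frac_le_eq divide_le_eq pos_le_divide_eq)
qed

lemma vertex_bounds:
  assumes q: "1 \<le> q" and a: "X / (8 * M\<^sup>2) * q \<le> a" "a \<le> \<kappa> * (X / M\<^sup>2) * q"
  shows "q * X / (2 * M) \<le> 2 * sqrt (a * q * X)" "2 * sqrt (a * q * X) \<le> 2 * \<kappa> * q * X / M"
proof -
  have qX: "0 \<le> q * X" using q X by simp
  have sq: "(2 * sqrt (a * q * X)) ^ 2 = 4 * (a * (q * X))" if "0 \<le> a"
    using that q X by (simp add: power_mult_distrib)
  have "0 \<le> X / (8 * M\<^sup>2) * q" using X q by simp
  then have a0: "0 \<le> a" using a by linarith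
  have "(q * X / (2 * M))\<^sup>2 \<le> 4 * (X / (8 * M\<^sup>2) * q * (q * X))"
    using M X q by (simp add: field_simps power2_eq_square)
  also have "\<dots> \<le> 4 * (a * (q * X))" using a(1) qX by (intro mult_left_mono mult_right_mono) auto
  also have "\<dots> = (2 * sqrt (a * q * X))\<^sup>2" using sq a0 by simp
  finally show "q * X / (2 * M) \<le> 2 * sqrt (a * q * X)"
    by (rule power2_le_imp_le) (use a0 q X in simp)
  have "(2 * sqrt (a * q * X))\<^sup>2 = 4 * (a * (q * X))" using sq a0 by simp
  also have "\<dots> \<le> 4 * (\<kappa> * (X / M\<^sup>2) * q * (q * X))"
    using a(2) qX by (intro mult_left_mono mult_right_mono) auto
  also have "\<dots> = 1 * \<kappa> * (2 * q * X / M)\<^sup>2"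
    by (simp add: power2_eq_square)
  \<comment> \<open>Enlarging \<kappa> to its square keeps \<open>sqrt \<kappa>\<close> out of the
    bound.\<close>
  also have "\<dots> \<le> \<kappa> * \<kappa> * (2 * q * X / M)\<^sup>2"
    using kappa_ge_1 by (intro mult_right_mono) auto
  also have "\<dots> = (2 * \<kappa> * q * X / M)\<^sup>2" by (simp add: power2_eq_square)
  finally show "2 * sqrt (a * q * X) \<le> 2 * \<kappa> * q * X / M"
    by (rule power2_le_imp_le) (use kappa_ge_1 q X M in simp)
qed

section \<open>Points of the strip and their assignment to fractions\<close>

lemma hyp_set_bounds:
  assumes "(m, n) \<in> hyp_set X H J"
  shows "M < of_int m" "of_int m \<le> 2 * M" "1 \<le> m" "1 \<le> n"
    "X < of_int n * of_int m" "of_int n * of_int m \<le> X + H"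
proof -
  show m: "M < of_int m" "of_int m \<le> 2 * M" and nm: "X < of_int n * of_int m"
    "of_int n * of_int m \<le> X + H"
    using assms J(2) by (auto simp: hyp_set_def)
  show "1 \<le> m" using m M by linarith
  then show "1 \<le> n" using nm X by (smt (verit) of_int_0_le_iff of_int_le_0_iff mult_nonpos_nonneg)
qed

lemma finite_hyp_set: "finite (hyp_set X H J)"
proof (rule finite_subset)
  show "hyp_set X H J \<subseteq> {0..\<lfloor>2 * M\<rfloor>} \<times> {0..\<lfloor>X + H\<rfloor>}"
  proof
    fix p assume "p \<in> hyp_set X H J"
    then obtain m n where p: "p = (m, n)" and mn: "(m, n) \<in> hyp_set X H J" by (metis surj_pair)
    note b = hyp_set_bounds[OF mn]
    have "real_of_int n \<le> of_int n * of_int m"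
      using mult_left_mono[of 1 "real_of_int m" "real_of_int n"] b by simp
    then have "real_of_int n \<le> X + H" using b by linarith
    then show "p \<in> {0..\<lfloor>2 * M\<rfloor>} \<times> {0..\<lfloor>X + H\<rfloor>}" using b by (auto simp: p le_floor_iff)
  qed
qed simp

text \<open>The third bound is where \<open>M <= C0 * sqrt X\<close> enters: slopes stay away from
  0, so an error of 1 costs only a constant factor.\<close>

lemma slope_bounds:
  assumes "M < m" "m \<le> 2 * M"
  shows "X / (4 * M\<^sup>2) \<le> X / m\<^sup>2" "X / m\<^sup>2 \<le> X / M\<^sup>2" "1 \<le> 4 * C0\<^sup>2 * (X / m\<^sup>2)"
proof -
  have m: "0 < m" "M\<^sup>2 \<le> m\<^sup>2" "m\<^sup>2 \<le> 4 * M\<^sup>2"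
    using assms M power_mono[of M m 2] power_mono[of m "2 * M" 2] by (auto simp: power_mult_distrib)
  show "X / (4 * M\<^sup>2) \<le> X / m\<^sup>2" "X / m\<^sup>2 \<le> X / M\<^sup>2"
    using m M X by (auto intro!: divide_left_mono mult_pos_pos)
  have "M\<^sup>2 \<le> (C0 * sqrt X)\<^sup>2" using M M_le by (intro power_mono) auto
  then have "M\<^sup>2 \<le> C0\<^sup>2 * X" using X by (simp add: power_mult_distrib)
  then show "1 \<le> 4 * C0\<^sup>2 * (X / m\<^sup>2)" using m by (simp add: field_simps)
qed

text \<open>
  For small \<open>Q\<close> the best numerator can be \<open>0\<close>, which the range prescribed for \<open>a\<close> excludes. This
  forces \<open>q = 1\<close> and \<open>Q = O(1)\<close>, so replacing \<open>0\<close> by \<open>1\<close> costs only the constant \<open>\<kappa>\<close>.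
\<close>

definition cell :: "int \<Rightarrow> int \<Rightarrow> (int \<times> int) set" where
  "cell q a = {(m, n) \<in> hyp_set X H J.
     int (approx_den Q (X / (of_int m)\<^sup>2)) = q \<and> max 1 (approx_num Q (X / (of_int m)\<^sup>2)) = a}"

lemma cell_props:
  assumes "(m, n) \<in> cell q a"
  shows "1 \<le> q" "q \<le> Q" "1 \<le> a" "coprime a q" "approx_num Q (X / (of_int m)\<^sup>2) \<in> {0, a}"
    "X / (8 * M\<^sup>2) * of_int q \<le> of_int a" "of_int a \<le> \<kappa> * (X / M\<^sup>2) * of_int q"
    "\<bar>of_int q * (X / (of_int m)\<^sup>2) - of_int a\<bar> \<le> \<kappa> / of_int Q"
proof -
  define \<alpha> where "\<alpha> = X / (real_of_int m)\<^sup>2"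
  define b where "b = approx_num Q \<alpha>"
  have mn: "(m, n) \<in> hyp_set X H J" and q: "q = int (approx_den Q \<alpha>)" and a: "a = max 1 b"
    using assms by (auto simp: cell_def \<alpha>_def b_def)
  have rq: "real (approx_den Q \<alpha>) = of_int q" by (simp add: q)
  note bd = hyp_set_bounds[OF mn]
  note dn = approx_den_num[OF Q_ge_1, of \<alpha>]
  show q1: "1 \<le> q" and qQ: "q \<le> Q" and a1: "1 \<le> a" using dn by (auto simp: q a)
  have \<alpha>: "X / (4 * M\<^sup>2) \<le> \<alpha>" "\<alpha> \<le> X / M\<^sup>2" "1 \<le> 4 * C0\<^sup>2 * \<alpha>"
    using slope_bounds[OF bd(1,2)] by (auto simp: \<alpha>_def)
  have \<alpha>0: "0 < \<alpha>" using X bd(3) by (simp add: \<alpha>_def)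
  have dev: "\<bar>of_int q * \<alpha> - of_int b\<bar> < 1 / of_int Q" using dn(3) by (simp add: rq b_def)
  have Q1: "1 / real_of_int Q \<le> 1" using Q_ge_1 by simp
  have q\<alpha>: "0 < of_int q * \<alpha>" using q1 \<alpha>0 by simp
  have b0: "0 \<le> b" using round_mono[of 0 "of_int q * \<alpha>"] q\<alpha> by (simp add: b_def approx_num_def rq)
  then show "approx_num Q (X / (of_int m)\<^sup>2) \<in> {0, a}" by (auto simp: a b_def \<alpha>_def)
  \<comment> \<open>Numerator 0 makes \<alpha> itself less than \<open>1 / Q\<close>, so
    \<open>0 / 1\<close> is admissible and the least denominator is 1.\<close>
  have b_zero: "q = 1 \<and> a = 1 \<and> \<alpha> < 1 / of_int Q" if "b = 0"
  proof -
    have d: "of_int q * \<alpha> < 1 / of_int Q" using dev that by simp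
    moreover have "1 * \<alpha> \<le> of_int q * \<alpha>" using q1 \<alpha>0 by (intro mult_right_mono) auto
    ultimately have "\<alpha> < 1 / of_int Q" by simp
    then have "approx_den Q \<alpha> \<le> 1" using \<alpha>0 by (intro approx_den_le[of 1 \<alpha> 0]) auto
    then show ?thesis using q1 q that a \<open>\<alpha> < _\<close> by auto
  qed
  have b_pos: "a = b" if "b \<noteq> 0" using that b0 a by simp
  show "coprime a q"
    using b_zero b_pos coprime_approx[OF Q_ge_1, of \<alpha>] by (cases "b = 0") (auto simp: q b_def)
  \<comment> \<open>The 1/8 in the range of \<open>a\<close> combines the 1/4 from
    \<open>m <= 2 * M\<close> with the factor 2 here.\<close>
  have "of_int q * \<alpha> \<le> 2 * of_int a"
  proof (cases "b = 0")
    case True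
    then have "\<alpha> < 1" using b_zero Q1 by linarith
    then show ?thesis using b_zero True by simp
  next
    case False
    then have "a = b" using b_pos by simp
    moreover have "1 \<le> real_of_int a" using a1 by simp
    ultimately show ?thesis using dev Q1 by linarith
  qed
  moreover have "X / (4 * M\<^sup>2) * of_int q \<le> \<alpha> * of_int q"
    using \<alpha> q1 by (intro mult_right_mono) auto
  ultimately show "X / (8 * M\<^sup>2) * of_int q \<le> of_int a" by (simp add: mult.commute)
  have one: "1 \<le> 4 * C0\<^sup>2 * (of_int q * \<alpha>)"
  proof -
    have "1 * (4 * C0\<^sup>2 * \<alpha>) \<le> of_int q * (4 * C0\<^sup>2 * \<alpha>)"
      using q1 \<alpha> by (intro mult_right_mono) auto
    then show ?thesis using \<alpha>(3) by (simp add: algebra_simps)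
  qed
  \<comment> \<open>The additive 1 covers both the approximation error and the replacement of
    numerator 0 by 1; \<kappa> absorbs it.\<close>
  have "of_int a \<le> of_int q * \<alpha> + 1"
    using dev Q1 b_zero b_pos q\<alpha> by (cases "b = 0") auto
  also have "\<dots> \<le> \<kappa> * (of_int q * \<alpha>)" using one by (simp add: \<kappa>_def algebra_simps)
  also have "\<dots> \<le> \<kappa> * (of_int q * (X / M\<^sup>2))"
    using \<alpha> q1 kappa_ge_1 by (intro mult_left_mono) auto
  finally show "of_int a \<le> \<kappa> * (X / M\<^sup>2) * of_int q" by (simp add: mult_ac)
  show "\<bar>of_int q * (X / (of_int m)\<^sup>2) - of_int a\<bar> \<le> \<kappa> / of_int Q"
  proof (cases "b = 0")
    case True
    then have z: "q = 1" "a = 1" "\<alpha> < 1 / of_int Q" using b_zero by auto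
    then have "\<bar>of_int q * \<alpha> - of_int a\<bar> \<le> 1" using Q1 \<alpha>0 by simp
    \<comment> \<open>The slope is bounded below by a constant and yet is less than
      \<open>1 / Q\<close>, so an error of 1 is a bounded multiple of \<open>1 / Q\<close>.\<close>
    also have "1 \<le> 4 * C0\<^sup>2 * \<alpha>" by fact
    also have "\<dots> \<le> 4 * C0\<^sup>2 * (1 / of_int Q)" using z by (intro mult_left_mono) auto
    also have "\<dots> \<le> \<kappa> / of_int Q" using Q_ge_1 by (simp add: \<kappa>_def divide_right_mono)
    finally show ?thesis by (simp add: \<alpha>_def)
  next
    case False
    have "1 / of_int Q \<le> \<kappa> / of_int Q" using kappa_ge_1 Q_ge_1 by (intro divide_right_mono) auto
    then show ?thesis using dev b_pos[OF False] by (simp add: \<alpha>_def)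
  qed
qed

section \<open>Distance of the occupied lines from tangency\<close>

text \<open>From \<open>c^2 - c'^2 = d^2 + 4 * a * q * (n * m - X)\<close>: the right side is
  positive, which gives \<open>c' < c\<close>; bounding it above and dividing by
  \<open>c + c' >= 2 * c'\<close> gives the second claim.\<close>

lemma line_offset:
  assumes mn: "(m, n) \<in> cell q a"
  defines "c \<equiv> real_of_int (a * m + q * n)" and "c' \<equiv> 2 * sqrt (of_int a * of_int q * X)"
  shows "c' < c" "c - c' \<le> \<tau> * R (of_int q)"
proof -
  note p = cell_props[OF mn]
  have "(m, n) \<in> hyp_set X H J" using mn by (simp add: cell_def)
  note bd = hyp_set_bounds[OF this]
  define m' n' q' a' Q' where "m' = real_of_int m" and "n' = real_of_int n"
    and "q' = real_of_int q" and "a' = real_of_int a" and "Q' = real_of_int Q"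
  note defs = m'_def n'_def q'_def a'_def Q'_def
  have pos: "M < m'" "m' \<le> 2 * M" "1 \<le> m'" "1 \<le> n'" "X < n' * m'" "n' * m' \<le> X + H"
    "1 \<le> q'" "q' \<le> Q'" "1 \<le> a'"
    using p bd by (auto simp: defs)
  have c: "c = a' * m' + q' * n'" by (simp add: c_def defs)
  have cs: "c'\<^sup>2 = 4 * a' * q' * X"
    using pos X by (simp add: c'_def defs power_mult_distrib)
  have cs_lower: "q' * X / (2 * M) \<le> c'" and cs_upper: "c' \<le> 2 * \<kappa> * q' * X / M"
    using vertex_bounds[of "real_of_int q" "real_of_int a"] p by (auto simp: c'_def defs)
  have "0 < q' * X / (2 * M)" using pos X M by simp
  then have cs_pos: "0 < c'" using cs_lower by linarith
  define d where "d = a' * m' - q' * n'"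
  have c2: "c\<^sup>2 - c'\<^sup>2 = d\<^sup>2 + 4 * a' * q' * (n' * m' - X)"
    unfolding c d_def cs by (simp add: algebra_simps power2_eq_square)
  moreover have "0 < 4 * a' * q' * (n' * m' - X)" using pos by simp
  ultimately have "c'\<^sup>2 < c\<^sup>2" using zero_le_power2[of d] by linarith
  moreover have "0 < c" unfolding c using pos by (intro add_pos_pos) auto
  ultimately show lt: "c' < c" using power_less_imp_less_base by fastforce
  \<comment> \<open>As \<open>m * d = a * m^2 - q * n * m\<close> and \<open>n * m\<close> exceeds
    \<open>X\<close> by at most \<open>H\<close>, \<open>d\<close> measures the error of
    \<open>a\<close> as an approximation to \<open>q * X / m^2\<close>, up to a term
    \<open>q * H / m\<close> that \<open>Q_squared\<close> bounds by \<open>M / Q\<close>.\<close>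
  have d_le: "\<bar>d\<bar> \<le> (2 * \<kappa> + 1) * M / Q'"
  proof -
    have "m' * d = - (m'\<^sup>2 * (q' * (X / m'\<^sup>2) - a')) - q' * (n' * m' - X)"
      using pos by (simp add: d_def field_simps power2_eq_square)
    then have "\<bar>m' * d\<bar> \<le> \<bar>m'\<^sup>2 * (q' * (X / m'\<^sup>2) - a')\<bar> + \<bar>q' * (n' * m' - X)\<bar>"
      by linarith
    also have "\<bar>m'\<^sup>2 * (q' * (X / m'\<^sup>2) - a')\<bar> \<le> m'\<^sup>2 * (\<kappa> / Q')"
      using mult_left_mono[OF p(8), of "m'\<^sup>2"] by (simp add: abs_mult defs)
    also have "\<bar>q' * (n' * m' - X)\<bar> \<le> q' * H"
      using pos by (auto simp: abs_mult intro: mult_left_mono)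
    also have "m'\<^sup>2 * (\<kappa> / Q') + q' * H = m' * (m' * \<kappa> / Q' + q' * H / m')"
      using pos by (simp add: distrib_left power2_eq_square)
    finally have "m' * \<bar>d\<bar> \<le> m' * (m' * \<kappa> / Q' + q' * H / m')"
      using pos by (simp add: abs_mult)
    then have "\<bar>d\<bar> \<le> m' * \<kappa> / Q' + q' * H / m'" using pos by simp
    also have "m' * \<kappa> / Q' \<le> 2 * M * \<kappa> / Q'"
      using pos kappa_ge_1 by (intro divide_right_mono mult_right_mono) auto
    also have "q' * H / m' \<le> q' * H / M"
      using pos H M by (intro divide_left_mono) auto
    also have "\<dots> \<le> M / Q'"
    proof -
      have "q' * H * Q' \<le> Q' * H * Q'" using pos H by (intro mult_right_mono) auto
      also have "\<dots> \<le> M * M" using Q_squared by (simp add: defs power2_eq_square mult_ac)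
      finally show ?thesis using M pos by (simp add: field_simps)
    qed
    finally show ?thesis by (simp add: add_divide_distrib algebra_simps)
  qed
  have "(c - c') * (2 * c') \<le> (c - c') * (c + c')" using lt cs_pos by (intro mult_left_mono) auto
  also have "\<dots> = c\<^sup>2 - c'\<^sup>2" by (simp add: algebra_simps power2_eq_square)
  also have "\<dots> \<le> ((2 * \<kappa> + 1) * M / Q')\<^sup>2 + 4 * a' * q' * H"
  proof -
    have "d\<^sup>2 \<le> ((2 * \<kappa> + 1) * M / Q')\<^sup>2" using power_mono[OF d_le, of 2] by simp
    moreover have "4 * a' * q' * (n' * m' - X) \<le> 4 * a' * q' * H"
      using pos by (intro mult_left_mono) auto
    ultimately show ?thesis using c2 by linarith
  qed
  \<comment> \<open>Written through \<open>c'\<close>, this term leaves only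
    \<open>H * c' / (2 * X)\<close> after the division by \<open>2 * c'\<close>.\<close>
  also have "4 * a' * q' * H = c' * (H * c' / X)" using arg_cong[OF cs, of "\<lambda>t. t * H / X"] X
    by (simp add: power2_eq_square mult_ac)
  finally have "c - c' \<le> (((2 * \<kappa> + 1) * M / Q')\<^sup>2 + c' * (H * c' / X)) / (2 * c')"
    using cs_pos by (simp only: pos_le_divide_eq mult_pos_pos zero_less_numeral)
  also have "\<dots> = ((2 * \<kappa> + 1) * M / Q')\<^sup>2 / (2 * c') + H * c' / (2 * X)"
    using cs_pos by (simp add: add_divide_distrib mult.commute)
  also have "((2 * \<kappa> + 1) * M / Q')\<^sup>2 / (2 * c') \<le> ((2 * \<kappa> + 1) * M / Q')\<^sup>2 / (2 * (q' * X / (2 * M)))"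
    by (intro divide_left_mono mult_pos_pos zero_le_power2;
        use cs_lower cs_pos \<open>0 < q' * X / (2 * M)\<close> in linarith)
  also have "\<dots> = (2 * \<kappa> + 1)\<^sup>2 * R q'"
    using M X pos by (simp add: R_def defs field_simps eval_nat_numeral)
  also have "H * c' / (2 * X) \<le> H * (2 * \<kappa> * q' * X / M) / (2 * X)"
    using cs_upper H X by (intro divide_right_mono mult_left_mono) auto
  also have "\<dots> = \<kappa> * (q' * H / M)" using X M by (simp add: field_simps)
  also have "\<dots> \<le> \<kappa> * R q'"
    using strip_height_le[of q'] pos kappa_ge_1 by (intro mult_left_mono) (auto simp: defs)
  finally show "c - c' \<le> \<tau> * R (of_int q)" by (simp add: \<tau>_def defs algebra_simps)
qed

section \<open>Splitting a cell into progressions\<close>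

text \<open>
  The numerator is recorded in the key because the slopes with numerators \<open>0\<close> and \<open>1\<close>, both
  belonging to \<open>cell 1 1\<close>, need not form a single interval.
\<close>

fun key :: "int \<Rightarrow> int \<Rightarrow> int \<times> int \<Rightarrow> int \<times> int \<times> bool \<times> int" where
  "key q a (m, n) =
     (approx_num Q (X / (of_int m)\<^sup>2), a * m + q * n, 0 \<le> a * m - q * n, m div (q * int K))"

text \<open>Taking the fibres of \<open>key\<close> over the attained keys makes the members
  nonempty and disjoint, and bounds their number by the number of keys.\<close>

definition Fam :: "int \<Rightarrow> int \<Rightarrow> (int \<times> int) set set" where
  "Fam q a = (\<lambda>k. {p \<in> cell q a. key q a p = k}) ` key q a ` cell q a"

lemma cell_subset: "cell q a \<subseteq> hyp_set X H J" by (auto simp: cell_def)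

lemma finite_cell: "finite (cell q a)" using finite_hyp_set cell_subset by (rule finite_subset[rotated])

text \<open>On a line, \<open>4 * a * q * n * m = c^2 - d^2\<close> with \<open>d\<close> increasing
  in \<open>m\<close>. While \<open>d\<close> keeps its sign, \<open>d^2\<close> is monotone, so at
  an intermediate point \<open>n * m\<close> lies between its values at the ends. Interval
  membership of \<open>m\<close>, the fraction (by \<open>cell_convex\<close>) and the block index
  are likewise inherited from the ends.\<close>

lemma Fam_is_AP:
  assumes "P \<in> Fam q a"
  shows "is_AP P (q, - a) (H * of_int Q / M)"
proof -
  obtain p0 where p0: "p0 \<in> cell q a" and P: "P = {p \<in> cell q a. key q a p = key q a p0}"
    using assms by (auto simp: Fam_def)
  obtain b c s k where key0: "key q a p0 = (b, c, s, k)" by (metis prod_cases4)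
  have inP: "(m, n) \<in> P \<longleftrightarrow> (m, n) \<in> cell q a \<and> approx_num Q (X / (of_int m)\<^sup>2) = b \<and>
      a * m + q * n = c \<and> (0 \<le> a * m - q * n) = s \<and> m div (q * int K) = k" for m n
    by (auto simp: P key0)
  obtain m0 n0 where "p0 = (m0, n0)" by (metis surj_pair)
  then have cp: "1 \<le> q" "1 \<le> a" "coprime a q" using cell_props[of m0 n0 q a] p0 by auto
  show ?thesis
  proof (rule convex_line_set_is_AP)
    show "finite P" using finite_cell by (simp add: P)
    show "P \<noteq> {}" using p0 unfolding P by blast
  next
    fix m n m1 n1 m2 n2
    assume p1: "(m1, n1) \<in> P" and p2: "(m2, n2) \<in> P" and m: "m1 \<le> m" "m \<le> m2"
      and line: "a * m + q * n = c"
    have h: "(m1, n1) \<in> hyp_set X H J" "(m2, n2) \<in> hyp_set X H J"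
      using p1 p2 inP cell_subset by blast+
    note bd1 = hyp_set_bounds[OF h(1)] and bd2 = hyp_set_bounds[OF h(2)]
    have J': "real_of_int m \<in> J"
    proof (rule mem_is_interval_1_I[OF J(1)])
      show "real_of_int m1 \<in> J" "real_of_int m2 \<in> J" using h by (auto simp: hyp_set_def)
    qed (use m in auto)
    \<comment> \<open>On the line, \<open>a * m - q * n\<close> depends on \<open>m\<close>
      alone.\<close>
    define d where "d t = 2 * a * t - c" for t
    have d_line: "a * u - q * v = d u" if "a * u + q * v = c" for u v
      using that by (simp add: d_def)
    have four: "4 * a * q * (v * u) = c\<^sup>2 - (d u)\<^sup>2" if "a * u + q * v = c" for u v
      unfolding d_line[OF that, symmetric] that[symmetric]
      by (simp add: power2_eq_square algebra_simps)
    have d: "d m1 \<le> d m" "d m \<le> d m2" using m cp by (auto simp: d_def mult_left_mono)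
    have l12: "a * m1 + q * n1 = c" "a * m2 + q * n2 = c" using p1 p2 unfolding inP by blast+
    have sg: "(0 \<le> d m1) = s" "(0 \<le> d m2) = s"
      using p1 p2 unfolding inP d_line[OF l12(1), symmetric] d_line[OF l12(2), symmetric] by blast+
    have sq: "(d m1)\<^sup>2 \<le> (d m)\<^sup>2 \<and> (d m)\<^sup>2 \<le> (d m2)\<^sup>2 \<or> (d m2)\<^sup>2 \<le> (d m)\<^sup>2 \<and> (d m)\<^sup>2 \<le> (d m1)\<^sup>2"
    proof (cases s)
      case True
      then show ?thesis using sg d by (simp add: power_mono)
    next
      case False
      then show ?thesis using sg d power_mono[of "- d m2" "- d m" 2] power_mono[of "- d m" "- d m1" 2]
        by simp
    qed
    have aq: "0 < 4 * a * q" using cp by simp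
    have "4 * a * q * (n1 * m1) \<le> 4 * a * q * (n * m) \<and> 4 * a * q * (n * m) \<le> 4 * a * q * (n2 * m2) \<or>
      4 * a * q * (n2 * m2) \<le> 4 * a * q * (n * m) \<and> 4 * a * q * (n * m) \<le> 4 * a * q * (n1 * m1)"
      unfolding four[OF line] four[OF l12(1)] four[OF l12(2)] using sq by linarith
    then have "n1 * m1 \<le> n * m \<and> n * m \<le> n2 * m2 \<or> n2 * m2 \<le> n * m \<and> n * m \<le> n1 * m1"
      using mult_le_cancel_left_pos[OF aq] by blast
    then have "real_of_int (n1 * m1) \<le> of_int (n * m) \<and> real_of_int (n * m) \<le> of_int (n2 * m2) \<or>
        real_of_int (n2 * m2) \<le> of_int (n * m) \<and> real_of_int (n * m) \<le> of_int (n1 * m1)"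
      by (simp only: of_int_le_iff)
    then have nm: "X < real_of_int (n * m) \<and> real_of_int (n * m) \<le> X + H"
      using bd1(5,6) bd2(5,6) unfolding of_int_mult by linarith
    have ord: "X / (of_int m2)\<^sup>2 \<le> X / (of_int m)\<^sup>2" "X / (of_int m)\<^sup>2 \<le> X / (of_int m1)\<^sup>2"
      using m bd1(3) X by (auto intro!: divide_left_mono power_mono mult_pos_pos)
    have dn: "int (approx_den Q (X / (of_int m1)\<^sup>2)) = q" "int (approx_den Q (X / (of_int m2)\<^sup>2)) = q"
      using p1 p2 inP by (auto simp: cell_def)
    have nu: "approx_num Q (X / (of_int m1)\<^sup>2) = b" "approx_num Q (X / (of_int m2)\<^sup>2) = b"
      using p1 p2 inP by auto
    have cc: "approx_den Q (X / (of_int m)\<^sup>2) = approx_den Q (X / (of_int m1)\<^sup>2)"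
      "approx_num Q (X / (of_int m)\<^sup>2) = approx_num Q (X / (of_int m1)\<^sup>2)"
      using cell_convex[OF Q_ge_1 _ _ ord] dn nu by auto
    have "(m, n) \<in> cell q a"
      using J' nm cc dn nu p1 inP by (auto simp: cell_def hyp_set_def)
    moreover have "m div (q * int K) = k"
    proof -
      have "m1 div (q * int K) = k" "m2 div (q * int K) = k" using p1 p2 inP by auto
      moreover have "m1 div (q * int K) \<le> m div (q * int K)" "m div (q * int K) \<le> m2 div (q * int K)"
        using m cp K(1) by (auto intro!: zdiv_mono1)
      ultimately show ?thesis by linarith
    qed
    moreover have "(0 \<le> a * m - q * n) = s" using d_line[OF line] d sg by auto
    ultimately show "(m, n) \<in> P" using inP line cc(2) nu by simp
  qed (use inP cp K in auto)
qed

section \<open>Counting the progressions\<close>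

text \<open>For \<open>d = a * m - q * n\<close> one has
  \<open>d^2 = u - 4 * a * q * (n * m - X)\<close>, which lies between \<open>u - B\<close> and
  \<open>u\<close>, so \<open>extent_le\<close> applies; along the line \<open>d\<close> changes by
  \<open>2 * a\<close> per unit of \<open>m\<close>.\<close>

lemma diam_on_line:
  assumes p: "(m, n) \<in> cell q a" "(m', n') \<in> cell q a"
    and c: "a * m + q * n = c" "a * m' + q * n' = c"
    and s: "(0 \<le> a * m - q * n) = (0 \<le> a * m' - q * n')"
  defines "u \<equiv> (real_of_int c)\<^sup>2 - 4 * of_int a * of_int q * X" and "B \<equiv> 4 * of_int a * of_int q * H"
  shows "2 * of_int a * of_int \<bar>m - m'\<bar> \<le> sqrt B"
    "2 * of_int a * of_int \<bar>m - m'\<bar> * sqrt u \<le> B"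
proof -
  have cp: "1 \<le> q" "1 \<le> a" using cell_props[OF p(1)] by auto
  have aq: "0 \<le> 4 * real_of_int a * of_int q" using cp by simp
  define d d' where "d = real_of_int (a * m - q * n)" and "d' = real_of_int (a * m' - q * n')"
  have bds: "u - B \<le> (real_of_int (a * x - q * y))\<^sup>2 \<and> (real_of_int (a * x - q * y))\<^sup>2 \<le> u"
    if "(x, y) \<in> cell q a" "a * x + q * y = c" for x y
  proof -
    have "(x, y) \<in> hyp_set X H J" using that cell_subset by blast
    note bd = hyp_set_bounds[OF this]
    have "4 * of_int a * of_int q * X \<le> 4 * of_int a * of_int q * (of_int y * of_int x)"
      "4 * of_int a * of_int q * (of_int y * of_int x) \<le> 4 * of_int a * of_int q * (X + H)"
      using bd by (intro mult_left_mono aq; simp)+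
    moreover have "(real_of_int (a * x - q * y))\<^sup>2 =
        (real_of_int c)\<^sup>2 - 4 * of_int a * of_int q * (of_int y * of_int x)"
      by (simp add: that(2)[symmetric] power2_eq_square algebra_simps)
    ultimately show ?thesis by (simp add: u_def B_def algebra_simps)
  qed
  have "\<bar>d - d'\<bar> \<le> sqrt B" "\<bar>d - d'\<bar> * sqrt u \<le> B"
    using bds[OF p(1) c(1)] bds[OF p(2) c(2)] s
    by (auto intro!: extent_le simp: d_def d'_def simp del: of_int_diff of_int_mult)
  moreover have "\<bar>d - d'\<bar> = 2 * of_int a * of_int \<bar>m - m'\<bar>"
  proof -
    have "(a * m - q * n) - (a * m' - q * n') = 2 * a * (m - m')"
      using c by (simp add: algebra_simps)
    then have "d - d' = of_int (2 * a * (m - m'))" unfolding d_def d'_def by (metis of_int_diff)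
    then show ?thesis using cp by (simp add: abs_mult)
  qed
  ultimately show "2 * of_int a * of_int \<bar>m - m'\<bar> \<le> sqrt B"
    "2 * of_int a * of_int \<bar>m - m'\<bar> * sqrt u \<le> B" by simp_all
qed

text \<open>The factor 4 counts the choices of numerator, 0 or \<open>a\<close>, and of the sign of
  \<open>d\<close>. Each summand bounds the blocks met by one such piece of the \<open>j\<close>-th
  line: 2 for edge effects plus its extent over the block width \<open>q * K\<close>.\<close>

lemma card_keys_le:
  assumes ne: "cell q a \<noteq> {}"
  defines "c' \<equiv> 2 * sqrt (of_int a * of_int q * X)" and "B \<equiv> 4 * of_int a * of_int q * H"
    and "N \<equiv> nat \<lfloor>\<tau> * R (of_int q)\<rfloor>"
  shows "real (card (key q a ` cell q a)) \<le>
    4 * (\<Sum>j\<le>N. 2 + (if j = 0 then sqrt B else B / sqrt (2 * c' * real j)) / (2 * of_int a * of_int q * real K))"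
proof -
  obtain m0 n0 where "(m0, n0) \<in> cell q a" using ne by auto
  then have cp: "1 \<le> q" "q \<le> Q" "1 \<le> a" using cell_props[of m0 n0 q a] by auto
  define f where "f j = (if j = 0 then sqrt B else B / sqrt (2 * c' * real j))" for j :: nat
  define line where "line j = \<lfloor>c'\<rfloor> + 1 + int j" for j :: nat
  define Fib where "Fib b j s = {(m, n) \<in> cell q a. approx_num Q (X / (of_int m)\<^sup>2) = b \<and>
    a * m + q * n = line j \<and> (0 \<le> a * m - q * n) = s}" for b j s
  define blocks where "blocks b j s = (\<lambda>m. m div (q * int K)) ` fst ` Fib b j s" for b j s
  define idx where "idx = {0, a} \<times> {..N} \<times> (UNIV :: bool set)"
  have c'_pos: "0 < c'" using cp X by (simp add: c'_def)
  have B: "0 < B" using cp H by (simp add: B_def)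
  have finite_Fib: "finite (Fib b j s)" for b j s
    using finite_cell by (rule finite_subset[rotated]) (auto simp: Fib_def)
  have card_blocks: "real (card (blocks b j s)) \<le> 2 + f j / (2 * of_int a * of_int q * real K)" for b j s
  proof -
    have "of_int \<bar>m - m'\<bar> \<le> f j / (2 * of_int a)"
      if m: "m \<in> fst ` Fib b j s" "m' \<in> fst ` Fib b j s" for m m'
    proof -
      obtain n n' where "(m, n) \<in> Fib b j s" "(m', n') \<in> Fib b j s" using m by auto
      then have diam: "2 * of_int a * of_int \<bar>m - m'\<bar> \<le> sqrt B"
        "2 * of_int a * of_int \<bar>m - m'\<bar> * sqrt ((real_of_int (line j))\<^sup>2 - 4 * of_int a * of_int q * X) \<le> B"
        using diam_on_line[of m n q a m' n' "line j"] by (auto simp: Fib_def B_def)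
      have "2 * of_int a * of_int \<bar>m - m'\<bar> \<le> f j"
      proof (cases "j = 0")
        case False
        have "real j \<le> of_int (line j) - c'" unfolding line_def by simp linarith
        then have "2 * c' * real j \<le> (of_int (line j) + c') * (of_int (line j) - c')"
          using c'_pos by (intro mult_mono) auto
        also have "\<dots> = (of_int (line j))\<^sup>2 - c'\<^sup>2" by (simp add: algebra_simps power2_eq_square)
        also have "c'\<^sup>2 = 4 * of_int a * of_int q * X" using cp X by (simp add: c'_def power_mult_distrib)
        finally have le: "sqrt (2 * c' * real j) \<le> sqrt ((real_of_int (line j))\<^sup>2 - 4 * of_int a * of_int q * X)"
          by (rule real_sqrt_le_mono)
        have "2 * of_int a * of_int \<bar>m - m'\<bar> * sqrt (2 * c' * real j) \<le>
            2 * of_int a * of_int \<bar>m - m'\<bar> * sqrt ((real_of_int (line j))\<^sup>2 - 4 * of_int a * of_int q * X)"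
          using le cp by (intro mult_left_mono) auto
        also note diam(2)
        finally show ?thesis using False c'_pos by (simp add: f_def pos_le_divide_eq)
      qed (use diam in \<open>simp add: f_def\<close>)
      then show ?thesis using cp by (simp add: pos_le_divide_eq mult.commute)
    qed
    moreover have "1 \<le> q * int K" using cp K(1) by (simp add: mult_pos_pos int_one_le_iff_zero_less)
    moreover have "0 \<le> f j / (2 * of_int a)" using B c'_pos cp by (simp add: f_def)
    ultimately have "real (card (blocks b j s)) \<le> f j / (2 * of_int a) / of_int (q * int K) + 2"
      unfolding blocks_def using finite_Fib by (intro card_blocks_le) auto
    then show ?thesis by (simp add: field_simps)
  qed
  have "key q a ` cell q a \<subseteq>
      (\<Union>(b, j, s) \<in> idx. (\<lambda>k. (b, line j, s, k)) ` blocks b j s)"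
  proof
    fix x assume "x \<in> key q a ` cell q a"
    then obtain m n where mn: "(m, n) \<in> cell q a" and x: "x = key q a (m, n)" by auto
    define c where "c = a * m + q * n"
    define j where "j = nat (c - \<lfloor>c'\<rfloor> - 1)"
    have off: "c' < of_int c" "of_int c - c' \<le> \<tau> * R (of_int q)"
      using line_offset[OF mn] by (auto simp: c_def c'_def)
    have "\<lfloor>c'\<rfloor> < c" using off(1) by (simp add: floor_less_iff)
    then have j: "int j = c - \<lfloor>c'\<rfloor> - 1" by (simp add: j_def)
    then have "line j = c" by (simp add: line_def)
    have "real_of_int (int j) \<le> \<tau> * R (of_int q)" unfolding j using off by simp linarith
    then have "int j \<le> \<lfloor>\<tau> * R (of_int q)\<rfloor>" by (simp only: le_floor_iff)
    then have "j \<le> N" by (simp add: N_def)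
    define b s where "b = approx_num Q (X / (of_int m)\<^sup>2)" and "s = (0 \<le> a * m - q * n)"
    have "b \<in> {0, a}" using cell_props(5)[OF mn] by (simp add: b_def)
    then have "(b, j, s) \<in> idx" using \<open>j \<le> N\<close> by (simp add: idx_def)
    moreover have "(m, n) \<in> Fib b j s" using mn \<open>line j = c\<close> by (simp add: Fib_def b_def s_def c_def)
    then have "m div (q * int K) \<in> blocks b j s" unfolding blocks_def by force
    then have "x \<in> (\<lambda>k. (b, line j, s, k)) ` blocks b j s"
      using x \<open>line j = c\<close> by (simp add: b_def s_def c_def)
    ultimately show "x \<in> (\<Union>(b, j, s) \<in> idx. (\<lambda>k. (b, line j, s, k)) ` blocks b j s)" by blast
  qed
  moreover have fin: "finite idx" by (simp add: idx_def)
  moreover have "finite (blocks b j s)" for b j s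
    by (simp add: blocks_def finite_Fib)
  ultimately have "card (key q a ` cell q a) \<le> card (\<Union>(b, j, s) \<in> idx. (\<lambda>k. (b, line j, s, k)) ` blocks b j s)"
    by (intro card_mono) auto
  also have "\<dots> \<le> (\<Sum>(b, j, s) \<in> idx. card ((\<lambda>k. (b, line j, s, k)) ` blocks b j s))"
    using card_UN_le[OF fin, of "\<lambda>(b, j, s). (\<lambda>k. (b, line j, s, k)) ` blocks b j s"]
    by (simp add: case_prod_beta)
  also have "\<dots> = (\<Sum>(b, j, s) \<in> idx. card (blocks b j s))"
    by (intro sum.cong) (auto intro!: card_image inj_onI)
  finally have "real (card (key q a ` cell q a)) \<le> (\<Sum>(b, j, s) \<in> idx. real (card (blocks b j s)))"
    by (simp add: case_prod_beta flip: of_nat_sum)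
  also have "\<dots> \<le> (\<Sum>(b, j, s) \<in> idx. 2 + f j / (2 * of_int a * of_int q * real K))"
    using card_blocks by (intro sum_mono) auto
  also have "\<dots> = (\<Sum>b\<in>{0, a}. \<Sum>j\<le>N. \<Sum>s\<in>(UNIV :: bool set). 2 + f j / (2 * of_int a * of_int q * real K))"
    unfolding idx_def by (simp only: sum.cartesian_product)
  also have "\<dots> = 4 * (\<Sum>j\<le>N. 2 + f j / (2 * of_int a * of_int q * real K))"
    using cp by (simp add: UNIV_bool sum_distrib_left)
  finally show ?thesis by (simp add: f_def)
qed

lemma card_keys_le_R:
  assumes ne: "cell q a \<noteq> {}"
  shows "real (card (key q a ` cell q a)) \<le> 40 * (\<tau> + 1) * R (of_int q)"
proof -
  obtain m0 n0 where "(m0, n0) \<in> cell q a" using ne by auto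
  note cp = cell_props[OF this]
  define q' a' Q' k where "q' = real_of_int q" and "a' = real_of_int a" and "Q' = real_of_int Q" and "k = real K"
  note defs = q'_def a'_def Q'_def k_def
  define c' B N where "c' = 2 * sqrt (a' * q' * X)" and "B = 4 * a' * q' * H"
    and "N = nat \<lfloor>\<tau> * R q'\<rfloor>"
  have pos: "1 \<le> q'" "1 \<le> a'" "1 \<le> Q'" "q' \<le> Q'" using cp Q_ge_1 by (auto simp: defs)
  have k: "1 \<le> k" "H * Q' / (2 * M) \<le> k" using K by (auto simp: defs)
  have R1: "1 \<le> R q'" using R_ge_1[of q'] pos by (simp add: defs)
  have N: "real N \<le> \<tau> * R q'" using tau_ge_1 R1 by (simp add: N_def)
  have cs_lower: "q' * X / (2 * M) \<le> c'"
    using vertex_bounds(1)[of q' a'] cp by (auto simp: c'_def defs)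
  have cs_pos: "0 < c'" using pos X by (simp add: c'_def)
  have cs: "c'\<^sup>2 = 4 * a' * q' * X" using pos X by (simp add: c'_def power_mult_distrib)
  have B: "0 < B" using pos H by (simp add: B_def)
  let ?f = "\<lambda>j::nat. if j = 0 then sqrt B else B / sqrt (2 * c' * real j)"
  have sum_f: "(\<Sum>j\<le>N. ?f j) \<le> sqrt B + B / sqrt (2 * c') * (2 * sqrt (\<tau> * R q'))"
  proof -
    have "(\<Sum>j\<le>N. ?f j) = sqrt B + (\<Sum>j=1..N. ?f j)"
      by (simp add: atMost_atLeast0 sum.atLeast_Suc_atMost)
    also have "(\<Sum>j=1..N. ?f j) = (\<Sum>j=1..N. B / sqrt (2 * c') * (1 / sqrt (real j)))"
      by (intro sum.cong) (auto simp: real_sqrt_mult)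
    also have "\<dots> = B / sqrt (2 * c') * (\<Sum>j=1..N. 1 / sqrt (real j))"
      by (simp add: sum_distrib_left)
    also have "\<dots> \<le> B / sqrt (2 * c') * (2 * sqrt (\<tau> * R q'))"
      using sum_inverse_sqrt_le[of N] N B cs_pos
      by (intro mult_left_mono) (auto intro: order_trans)
    finally show ?thesis by simp
  qed
  \<comment> \<open>Expressing \<open>sqrt B\<close> and \<open>a * q\<close> through
    \<open>c'\<close> removes \<open>a\<close>. The lower bounds for \<open>c'\<close> and
    \<open>k\<close> then leave an inequality equivalent to \<open>Q_sqrt\<close>.\<close>
  have first: "2 / (a' * q' * k) * sqrt B \<le> 32 * R q'"
  proof -
    have sB: "sqrt B = c' * sqrt (H / X)"
    proof (rule real_sqrt_unique)
      show "(c' * sqrt (H / X))\<^sup>2 = B" using cs X H by (simp add: power_mult_distrib B_def)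
    qed (use cs_pos X H in simp)
    have "2 / (a' * q' * k) * sqrt B = 8 * X * sqrt (H / X) / (c' * k)"
    proof -
      have "a' * q' = c'\<^sup>2 / (4 * X)" using cs X by simp
      then have "2 / (a' * q' * k) * sqrt B = 2 / (c'\<^sup>2 / (4 * X) * k) * (c' * sqrt (H / X))"
        by (simp only: sB)
      also have "\<dots> = 8 * X * sqrt (H / X) / (c' * k)"
        using cs_pos X k by (simp add: power2_eq_square)
      finally show ?thesis .
    qed
    also have "\<dots> \<le> 8 * X * sqrt (H / X) / ((q' * X / (2 * M)) * (H * Q' / (2 * M)))"
      using cs_lower k(2) cs_pos k pos X H M by (intro divide_left_mono mult_mono) auto
    also have "\<dots> = 32 * M\<^sup>2 * sqrt (H / X) / (q' * H * Q')"
      using pos X H M by (simp add: field_simps power2_eq_square)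
    also have "\<dots> \<le> 32 * R q'"
    proof -
      have "(Q' * sqrt X) * (sqrt H * M\<^sup>2 * sqrt X) \<le> (M * sqrt H) * (sqrt H * M\<^sup>2 * sqrt X)"
        using Q_sqrt X H by (intro mult_right_mono) (auto simp: defs)
      also have "\<dots> = H * M ^ 3 * sqrt X" using H by (simp add: eval_nat_numeral)
      finally have le: "Q' * sqrt X * (sqrt H * M\<^sup>2 * sqrt X) \<le> H * M ^ 3 * sqrt X" .
      have "M\<^sup>2 * sqrt (H / X) / (q' * H * Q') = Q' * sqrt X * (sqrt H * M\<^sup>2 * sqrt X) / (sqrt X * X * H * q' * Q'\<^sup>2)"
        using pos X H by (simp add: real_sqrt_divide field_simps power2_eq_square)
      also have "\<dots> \<le> H * M ^ 3 * sqrt X / (sqrt X * X * H * q' * Q'\<^sup>2)"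
        using le pos X H by (intro divide_right_mono) auto
      also have "\<dots> = R q'" using X H by (simp add: R_def defs field_simps)
      finally show ?thesis by simp
    qed
    finally show ?thesis .
  qed
  \<comment> \<open>Here \<open>a * q\<close> cancels against \<open>B\<close>; after the lower
    bounds for \<open>k\<close> and \<open>c'\<close> the leftover factor
    \<open>M / Q * sqrt (M / (q * X))\<close> is exactly \<open>sqrt (R q)\<close>.\<close>
  have rest: "2 / (a' * q' * k) * (B / sqrt (2 * c') * (2 * sqrt (\<tau> * R q'))) \<le> 32 * (\<tau> * R q')"
  proof -
    have "2 / (a' * q' * k) * (B / sqrt (2 * c') * (2 * sqrt (\<tau> * R q'))) =
        16 * H * sqrt (\<tau> * R q') / (k * sqrt (2 * c'))"
      using pos k cs_pos by (simp add: B_def field_simps)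
    also have "\<dots> \<le> 16 * H * sqrt (\<tau> * R q') / ((H * Q' / (2 * M)) * sqrt (q' * X / M))"
      using k cs_lower cs_pos pos X H M R1 tau_ge_1
      by (intro divide_left_mono mult_mono mult_nonneg_nonneg mult_pos_pos) (auto simp: field_simps)
    also have "\<dots> = 32 * sqrt (\<tau> * R q') * (M / Q' * sqrt (M / (q' * X)))"
      using pos X H M by (simp add: real_sqrt_divide field_simps)
    also have "M / Q' * sqrt (M / (q' * X)) = sqrt (R q')"
    proof (rule real_sqrt_unique[symmetric])
      have "(M / Q' * sqrt (M / (q' * X)))\<^sup>2 = (M / Q')\<^sup>2 * (M / (q' * X))"
        using pos X M by (subst power_mult_distrib) simp
      then show "(M / Q' * sqrt (M / (q' * X)))\<^sup>2 = R q'"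
        by (simp add: R_def defs power2_eq_square power3_eq_cube mult_ac)
    qed (use pos X M in simp)
    also have "32 * sqrt (\<tau> * R q') * sqrt (R q') \<le> 32 * sqrt (\<tau> * R q') * sqrt (\<tau> * R q')"
      using R1 tau_ge_1 mult_right_mono[of 1 \<tau> "R q'"] by (intro mult_left_mono) auto
    also have "\<dots> = 32 * (\<tau> * R q')" using R1 tau_ge_1 by simp
    finally show ?thesis .
  qed
  have "real (card (key q a ` cell q a)) \<le> 4 * (\<Sum>j\<le>N. 2 + ?f j / (2 * a' * q' * k))"
    unfolding c'_def B_def N_def defs by (rule card_keys_le[OF ne])
  also have "(\<Sum>j\<le>N. 2 + ?f j / (2 * a' * q' * k)) = 2 * (real N + 1) + (\<Sum>j\<le>N. ?f j) / (2 * a' * q' * k)"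
    by (simp add: sum.distrib sum_divide_distrib)
  also have "4 * \<dots> = 8 * (real N + 1) + 2 / (a' * q' * k) * (\<Sum>j\<le>N. ?f j)"
    by (simp add: algebra_simps)
  also have "\<dots> \<le> 8 * (\<tau> * R q' + R q') +
      2 / (a' * q' * k) * (sqrt B + B / sqrt (2 * c') * (2 * sqrt (\<tau> * R q')))"
    using N R1 sum_f pos k by (intro add_mono mult_left_mono) auto
  also have "\<dots> \<le> 8 * (\<tau> * R q' + R q') + (32 * R q' + 32 * (\<tau> * R q'))"
    unfolding distrib_left[of "2 / (a' * q' * k)"] using first rest by linarith
  finally show ?thesis by (simp add: defs algebra_simps)
qed

section \<open>Assembling the partition\<close>

lemma finite_Fam: "finite (Fam q a)" by (simp add: Fam_def finite_cell)

lemma card_Fam_le: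
  assumes "1 \<le> q"
  shows "real (card (Fam q a)) \<le> 40 * (\<tau> + 1) * R (of_int q)"
proof (cases "cell q a = {}")
  case True
  have "0 \<le> R (of_int q)" using M X assms by (simp add: R_def)
  then show ?thesis using True tau_ge_1 by (simp add: Fam_def)
next
  case False
  have "card (Fam q a) \<le> card (key q a ` cell q a)"
    unfolding Fam_def by (intro card_image_le finite_imageI finite_cell)
  then show ?thesis using card_keys_le_R[OF False] by linarith
qed

lemma Union_Fam: "\<Union> (Fam q a) = cell q a" by (auto simp: Fam_def)

text \<open>A point determines its cell, and within the cell its key.\<close>

lemma Fam_disjoint:
  assumes "P \<in> Fam q a" "P' \<in> Fam q' a'" "x \<in> P" "x \<in> P'"
  shows "(q, a, P) = (q', a', P')"
proof -
  have "x \<in> cell q a" "x \<in> cell q' a'" using assms Union_Fam by blast+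
  then have "q = q'" "a = a'" by (auto simp: cell_def)
  then show ?thesis using assms by (auto simp: Fam_def)
qed

end

theorem theorem8p1:
  fixes C0 :: real
  shows "\<exists>c1 c2 C. 0 < c1 \<and> c1 < c2 \<and> 0 < C \<and>
    (\<forall>(X::real) (H::real) (M::real) (J::real set) (Q::int).
       1 \<le> X \<and> 1 \<le> H \<and> 1 \<le> M \<and> X powr (1/3) \<le> H \<and> H \<le> X \<and> M \<le> C0 * sqrt X \<and>
       is_interval J \<and> J \<subseteq> {M<..2*M} \<and>
       M / H \<le> real_of_int Q \<and> real_of_int Q \<le> M / (H * X) powr (1/4)
     \<longrightarrow>
       (\<exists>Fam :: int \<Rightarrow> int \<Rightarrow> (int \<times> int) set set.
          let I = {(q, a). 1 \<le> q \<and> q \<le> Q \<and>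
                     c1 * (X / M\<^sup>2) * real_of_int q \<le> real_of_int a \<and>
                     real_of_int a \<le> c2 * (X / M\<^sup>2) * real_of_int q \<and> coprime a q}
          in (\<forall>(q, a) \<in> I. finite (Fam q a) \<and>
                real (card (Fam q a)) \<le> C * M ^ 3 / (X * (real_of_int Q)\<^sup>2 * real_of_int q) \<and>
                (\<forall>P \<in> Fam q a. P \<subseteq> hyp_set X H J \<and> is_AP P (q, - a) (H * real_of_int Q / M)))
           \<and> hyp_set X H J = (\<Union>(q, a) \<in> I. \<Union> (Fam q a))
           \<and> (\<forall>(q, a) \<in> I. \<forall>(q', a') \<in> I. \<forall>P \<in> Fam q a. \<forall>P' \<in> Fam q' a'.
                 (q, a, P) \<noteq> (q', a', P') \<longrightarrow> P \<inter> P' = {})))"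
proof -
  \<comment> \<open>These are \<kappa> and \<open>40 * (\<tau> + 1)\<close> spelled out, since the
    constants must be fixed from \<open>C0\<close> alone before the other parameters are
    introduced.\<close>
  define k where "k = 1 + 4 * C0\<^sup>2"
  define C where "C = 40 * ((2 * k + 1)\<^sup>2 + k + 1)"
  have k_ge: "1 \<le> k" by (simp add: k_def)
  then have C: "0 < C" by (simp add: C_def add_nonneg_pos)
  show ?thesis
  proof (rule exI[of _ "1 / 8"], rule exI[of _ k], rule exI[of _ C],
      intro conjI allI impI, goal_cases)
    case (4 X H M J Q)
    then interpret hyperbolic_strip C0 X H M J Q by unfold_locales auto
    have k_eq: "\<kappa> = k" by (simp add: \<kappa>_def k_def)
    have bound: "real (card (Fam q a)) \<le> C * M ^ 3 / (X * (of_int Q)\<^sup>2 * of_int q)" if "1 \<le> q" for q a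
      using card_Fam_le[OF that] by (simp add: C_def R_def \<tau>_def k_eq)
    have mem: "\<exists>q a. 1 \<le> q \<and> q \<le> Q \<and> 1 / 8 * (X / M\<^sup>2) * of_int q \<le> of_int a \<and>
        of_int a \<le> k * (X / M\<^sup>2) * of_int q \<and> coprime a q \<and> p \<in> \<Union> (Fam q a)"
      if "p \<in> hyp_set X H J" for p
    proof -
      obtain m n where p: "p = (m, n)" by (metis surj_pair)
      define q a where "q = int (approx_den Q (X / (of_int m)\<^sup>2))" and "a = max 1 (approx_num Q (X / (of_int m)\<^sup>2))"
      have mn: "(m, n) \<in> cell q a" using that by (simp add: cell_def p q_def a_def)
      show ?thesis using cell_props[OF mn] mn unfolding Union_Fam p k_eq
        by (intro exI[of _ q] exI[of _ a]) auto
    qed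
    have sub: "P \<subseteq> hyp_set X H J" if "P \<in> Fam q a" for P q a
      using that Union_Fam cell_subset by blast
    show ?case unfolding Let_def
    proof (rule exI[of _ Fam], intro conjI, goal_cases)
      case 1
      show ?case using bound finite_Fam Fam_is_AP sub by auto
    next
      case 2
      show ?case
      proof (intro equalityI subsetI)
        fix p assume "p \<in> hyp_set X H J"
        from mem[OF this] show "p \<in> (\<Union>(q, a) \<in> {(q, a). 1 \<le> q \<and> q \<le> Q \<and>
            1 / 8 * (X / M\<^sup>2) * real_of_int q \<le> real_of_int a \<and>
            real_of_int a \<le> k * (X / M\<^sup>2) * real_of_int q \<and> coprime a q}. \<Union> (Fam q a))"
          by blast
      qed (use sub in blast)
    next
      case 3
      show ?case using Fam_disjoint by blast
    qed
  qed (use k_ge C in auto)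
qed

end
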